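(* Let $\Gamma$ be a finitely generated group and let $(\rho_N)$ be a sequence of permutation representations $\rho_N:\Gamma\to S_N$ (along an infinite set of integers $N\to\infty$) which converges in distribution to the left regular representation $\lambda$. On a common probability space, for each $N$, let $(a_N(x))_{x\in[N]}$ be independent complex random variables such that $\|a_N\|_\infty=\max_x|a_N(x)|\le 1$ almost surely and such that the expectation of $a_N(x)$ does not depend on $x\in[N]$. Then almost surely, for all $g\in\Gamma$ with $g\neq e$, $$\sigma(g):=\limsup_{N\to\infty}\Bigl|\frac1N\sum_{x\in[N]}\overline{(a_N(x)-\langle a_N\rangle)}\,(a_N(g.x)-\langle a_N\rangle)\Bigr|=0 .$$ In particular, almost surely the sequence $(a_N)$ is asymptotically uncorrelated, i.e. $\lim_{|g|\to\infty}\sigma(g)=0$.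
   Context: $[N]=\{1,\dots,N\}$ and $e$ is the unit of $\Gamma$. A permutation representation is a homomorphism $\rho_N:\Gamma\to S_N$ into the group of permutations of $[N]$; we write $g.x=\rho_N(g)(x)$ and identify $\rho_N(g)$ with its permutation matrix $\rho_N(g)(x,y)=\mathbf 1(x=g.y)$. The sequence $(\rho_N)$ converges in distribution to $\lambda$ if $\frac1N\mathrm{Tr}(\rho_N(g))\to0$ as $N\to\infty$ for every $g\in\Gamma\setminus\{e\}$. For $a_N\in\mathbb C^N$, $\langle a_N\rangle=\frac1N\sum_{x\in[N]}a_N(x)$. $|g|$ is the word length of $g$ with respect to a fixed finite generating set of $\Gamma$. *)

theory Defs
  imports "HOL-Probability.Probability" "HOL-Algebra.Sym_Groups"
begin

text \<open>The set \<open>[N]\<close> is \<open>{1..N}\<close>, and \<open>sym_group N\<close> is the group of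
  permutations of \<open>{1..N}\<close>. A permutation representation of \<open>G\<close> on \<open>[N]\<close> is
  an element of \<open>hom G (sym_group N)\<close>.\<close>

definition along :: "nat set \<Rightarrow> nat filter" where
  "along I = inf sequentially (principal I)"

definition perm_matrix :: "(nat \<Rightarrow> nat) \<Rightarrow> nat \<Rightarrow> nat \<Rightarrow> complex" where
  "perm_matrix p x y = (if x = p y then 1 else 0)"

definition matrix_trace :: "nat \<Rightarrow> (nat \<Rightarrow> nat \<Rightarrow> complex) \<Rightarrow> complex" where
  "matrix_trace N A = (\<Sum>x\<in>{1..N}. A x x)"

definition converges_to_regular ::
  "('g, 'm) monoid_scheme \<Rightarrow> nat set \<Rightarrow> (nat \<Rightarrow> 'g \<Rightarrow> nat \<Rightarrow> nat) \<Rightarrow> bool" where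
  "converges_to_regular G I \<rho> \<longleftrightarrow>
     (\<forall>g\<in>carrier G - {\<one>\<^bsub>G\<^esub>}.
        ((\<lambda>N. matrix_trace N (perm_matrix (\<rho> N g)) / of_nat N) \<longlongrightarrow> 0) (along I))"

text \<open>Only meaningful for \<open>g\<close> in the subgroup generated by \<open>S\<close>; for other
  \<open>g\<close> the \<open>LEAST\<close> is over an empty predicate.\<close>

definition word_length :: "('g, 'm) monoid_scheme \<Rightarrow> 'g set \<Rightarrow> 'g \<Rightarrow> nat" where
  "word_length G S g =
     (LEAST n. \<exists>ws. length ws = n \<and> set ws \<subseteq> S \<union> (\<lambda>s. inv\<^bsub>G\<^esub> s) ` S \<and>
        foldr (\<lambda>s h. s \<otimes>\<^bsub>G\<^esub> h) ws \<one>\<^bsub>G\<^esub> = g)"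

definition avg :: "nat \<Rightarrow> (nat \<Rightarrow> complex) \<Rightarrow> complex" where
  "avg N a = (\<Sum>x\<in>{1..N}. a x) / of_nat N"

definition autocorrelation :: "nat \<Rightarrow> (nat \<Rightarrow> complex) \<Rightarrow> (nat \<Rightarrow> nat) \<Rightarrow> complex" where
  "autocorrelation N a p =
     (\<Sum>x\<in>{1..N}. cnj (a x - avg N a) * (a (p x) - avg N a)) / of_nat N"

definition asymp_correlation ::
  "nat set \<Rightarrow> (nat \<Rightarrow> 'g \<Rightarrow> nat \<Rightarrow> nat) \<Rightarrow> (nat \<Rightarrow> nat \<Rightarrow> complex) \<Rightarrow> 'g \<Rightarrow> ereal" where
  "asymp_correlation I \<rho> a g =
     Limsup (along I) (\<lambda>N. ereal (cmod (autocorrelation N (a N) (\<rho> N g))))"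

text \<open>The filter expresses \<open>g \<in> carrier G\<close>, \<open>|g| \<rightarrow> \<infinity>\<close>. It is trivial when \<open>G\<close> is finite,
  and then the condition is vacuous.\<close>

definition asymp_uncorrelated ::
  "('g, 'm) monoid_scheme \<Rightarrow> 'g set \<Rightarrow> nat set \<Rightarrow> (nat \<Rightarrow> 'g \<Rightarrow> nat \<Rightarrow> nat)
     \<Rightarrow> (nat \<Rightarrow> nat \<Rightarrow> complex) \<Rightarrow> bool" where
  "asymp_uncorrelated G S I \<rho> a \<longleftrightarrow>
     (asymp_correlation I \<rho> a \<longlongrightarrow> 0)
       (inf (filtercomap (word_length G S) at_top) (principal (carrier G)))"

end

theory Submission
  imports Defs
begin

text \<open>
  Fix \<open>g \<noteq> \<one>\<close> and write \<open>p = \<rho>\<^sub>N(g)\<close>, a permutation of \<open>{1..N}\<close>. Subtracting the common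
  expectation \<open>\<mu>\<^sub>N\<close> from the variables leaves the autocorrelation unchanged, and since \<open>p\<close> preserves
  sums over \<open>{1..N}\<close>, the centred variables \<open>X x = a x - \<mu>\<^sub>N\<close> satisfy
  \<open>autocorrelation = (\<Sum>x. cnj (X x) * X (p x)) / N - \<bar>avg X\<bar>\<^sup>2\<close>.
  Here \<open>avg X\<close> is a normalised sum of bounded independent centred variables, so it is small. In the
  first term the fixed points of \<open>p\<close> contribute at most \<open>4 * card {x. p x = x} / N\<close>, and convergence
  to the regular representation says exactly that this tends to \<open>0\<close>.

  The remaining products \<open>cnj (X x) * X (p x)\<close> with \<open>p x \<noteq> x\<close> are centred and bounded by \<open>4\<close>, but
  they are dependent: the products at \<open>x\<close> and at \<open>p x\<close> share a factor. The graph that joins \<open>x\<close> to \<open>p x\<close>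
  has degree at most two, so three colours suffice to give \<open>x\<close> and \<open>p x\<close> different colours
  (\<open>ex_permutation_3_colouring\<close>). Within a colour class the pairs \<open>{x, p x}\<close> are disjoint, hence
  the products are independent (\<open>indep_vars_cnj_mult_shift\<close>), and the class sum is again a sum of
  bounded independent centred variables.

  Everything thus reduces to \<open>AE_normalized_sum_tendsto_0\<close>: Hoeffding's inequality bounds the
  probability that such a sum exceeds \<open>\<epsilon> N\<close> by a quantity exponentially small in \<open>N\<close>, and
  Borel-Cantelli gives almost sure convergence. The exceptional null set depends on \<open>g\<close>; the group is
  finitely generated, hence countable, so the union of these null sets is still null. The limit
  for \<open>\<bar>g\<bar> \<rightarrow> \<infinity>\<close> is then immediate, because the correlation vanishes for all \<open>g\<close>
  with \<open>\<bar>g\<bar> > \<bar>\<one>\<bar>\<close>.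
\<close>

section \<open>Concentration for sums of bounded complex variables\<close>

lemma eventually_along: "eventually P (along I) \<longleftrightarrow> (\<forall>\<^sub>F N in sequentially. N \<in> I \<longrightarrow> P N)"
  by (simp add: along_def eventually_inf_principal)

context prob_space
begin

lemma prob_abs_sum_centred_ge:
  fixes X :: "'i \<Rightarrow> 'a \<Rightarrow> real"
  assumes fin: "finite A" and ind: "indep_vars (\<lambda>_. borel) X A"
    and bnd: "\<And>i. i \<in> A \<Longrightarrow> AE \<omega> in M. \<bar>X i \<omega>\<bar> \<le> K"
    and mean: "\<And>i. i \<in> A \<Longrightarrow> expectation (X i) = 0"
    and card: "card A \<le> N" and K: "K > 0" and \<epsilon>: "\<epsilon> > 0" and N: "N > 0"
  shows "prob {\<omega> \<in> space M. \<bar>\<Sum>i\<in>A. X i \<omega>\<bar> \<ge> \<epsilon> * N} \<le> 2 * exp (- (\<epsilon>\<^sup>2 / (2 * K\<^sup>2)) * N)"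
proof (cases "A = {}")
  \<comment> \<open>Hoeffding's exponent has the total squared width in the denominator, which is zero for the empty sum.\<close>
  case True
  moreover have "\<not> \<epsilon> * real N \<le> 0"
    using \<epsilon> N by (simp add: not_le)
  ultimately show ?thesis by simp
next
  case False
  interpret Hoeffding_ineq M A X "\<lambda>_. - K" "\<lambda>_. K" 0
  proof unfold_locales
    fix i assume "i \<in> A"
    then show "AE x in M. X i x \<in> {- K..K}"
      using bnd[of i] by (auto elim!: eventually_mono)
  qed (use assms in auto)
  have c: "card A > 0"
    using False fin by (simp add: card_gt_0_iff)
  have "prob {\<omega> \<in> space M. \<bar>(\<Sum>i\<in>A. X i \<omega>) - 0\<bar> \<ge> \<epsilon> * N}
      \<le> 2 * exp (- 2 * (\<epsilon> * N)\<^sup>2 / (\<Sum>i\<in>A. (K - - K)\<^sup>2))"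
    using \<epsilon> K c by (intro Hoeffding_ineq_abs_ge) auto
  also have "(\<Sum>i\<in>A. (K - - K)\<^sup>2) = card A * (4 * K\<^sup>2)"
    by (simp add: power2_eq_square)
  also have "- 2 * (\<epsilon> * N)\<^sup>2 / (card A * (4 * K\<^sup>2)) \<le> - (\<epsilon>\<^sup>2 / (2 * K\<^sup>2)) * N"
  proof -
    have "(\<epsilon>\<^sup>2 / (2 * K\<^sup>2)) * N = (\<epsilon>\<^sup>2 * N\<^sup>2) / (N * (2 * K\<^sup>2))"
      using N by (simp add: power2_eq_square)
    also have "\<dots> \<le> (\<epsilon>\<^sup>2 * N\<^sup>2) / (card A * (2 * K\<^sup>2))"
      using card K c by (intro divide_left_mono mult_right_mono mult_pos_pos) auto
    finally show ?thesis
      by (simp add: power_mult_distrib field_simps)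
  qed
  finally show ?thesis by simp
qed

text \<open>If \<open>\<bar>z\<bar> \<ge> \<epsilon> N\<close>, then the real or the imaginary part of \<open>z\<close> is at least \<open>\<epsilon> N / 2\<close> in absolute value,
  so a union bound over the two real sums suffices.\<close>

lemma prob_cmod_sum_centred_ge:
  fixes X :: "'i \<Rightarrow> 'a \<Rightarrow> complex"
  assumes fin: "finite A" and ind: "indep_vars (\<lambda>_. borel) X A"
    and bnd: "\<And>i. i \<in> A \<Longrightarrow> AE \<omega> in M. cmod (X i \<omega>) \<le> K"
    and mean: "\<And>i. i \<in> A \<Longrightarrow> expectation (X i) = 0"
    and card: "card A \<le> N" and K: "K > 0" and \<epsilon>: "\<epsilon> > 0" and N: "N > 0"
  shows "prob {\<omega> \<in> space M. cmod (\<Sum>i\<in>A. X i \<omega>) \<ge> \<epsilon> * N} \<le> 4 * exp (- (\<epsilon>\<^sup>2 / (8 * K\<^sup>2)) * N)"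
proof -
  have meas [measurable]: "X i \<in> borel_measurable M" if "i \<in> A" for i
    using ind that by (simp add: indep_vars_def)
  have int: "integrable M (X i)" if "i \<in> A" for i
    using bnd[OF that] meas[OF that] by (rule integrable_const_bound)
  have re: "prob {\<omega> \<in> space M. \<bar>\<Sum>i\<in>A. Re (X i \<omega>)\<bar> \<ge> (\<epsilon> / 2) * N}
      \<le> 2 * exp (- ((\<epsilon> / 2)\<^sup>2 / (2 * K\<^sup>2)) * N)"
  proof (rule prob_abs_sum_centred_ge[OF fin])
    show "indep_vars (\<lambda>_. borel) (\<lambda>i \<omega>. Re (X i \<omega>)) A"
      by (rule indep_vars_compose2[OF ind]) simp
    fix i assume i: "i \<in> A"
    show "AE \<omega> in M. \<bar>Re (X i \<omega>)\<bar> \<le> K"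
      using bnd[OF i] by eventually_elim (meson abs_Re_le_cmod order_trans)
    show "expectation (\<lambda>\<omega>. Re (X i \<omega>)) = 0"
      using mean[OF i] int[OF i] by simp
  qed (use assms in auto)
  have im: "prob {\<omega> \<in> space M. \<bar>\<Sum>i\<in>A. Im (X i \<omega>)\<bar> \<ge> (\<epsilon> / 2) * N}
      \<le> 2 * exp (- ((\<epsilon> / 2)\<^sup>2 / (2 * K\<^sup>2)) * N)"
  proof (rule prob_abs_sum_centred_ge[OF fin])
    show "indep_vars (\<lambda>_. borel) (\<lambda>i \<omega>. Im (X i \<omega>)) A"
      by (rule indep_vars_compose2[OF ind]) simp
    fix i assume i: "i \<in> A"
    show "AE \<omega> in M. \<bar>Im (X i \<omega>)\<bar> \<le> K"
      using bnd[OF i] by eventually_elim (meson abs_Im_le_cmod order_trans)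
    show "expectation (\<lambda>\<omega>. Im (X i \<omega>)) = 0"
      using mean[OF i] int[OF i] by simp
  qed (use assms in auto)
  have "prob {\<omega> \<in> space M. cmod (\<Sum>i\<in>A. X i \<omega>) \<ge> \<epsilon> * N}
      \<le> prob ({\<omega> \<in> space M. \<bar>\<Sum>i\<in>A. Re (X i \<omega>)\<bar> \<ge> (\<epsilon> / 2) * N} \<union>
              {\<omega> \<in> space M. \<bar>\<Sum>i\<in>A. Im (X i \<omega>)\<bar> \<ge> (\<epsilon> / 2) * N})"
  proof (rule finite_measure_mono)
    have "\<epsilon> / 2 * N \<le> \<bar>Re z\<bar> \<or> \<epsilon> / 2 * N \<le> \<bar>Im z\<bar>" if "\<epsilon> * N \<le> cmod z" for z
      using cmod_le[of z] that by linarith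
    from this[of "\<Sum>i\<in>A. X i \<omega>" for \<omega>]
    show "{\<omega> \<in> space M. cmod (\<Sum>i\<in>A. X i \<omega>) \<ge> \<epsilon> * N}
        \<subseteq> {\<omega> \<in> space M. \<bar>\<Sum>i\<in>A. Re (X i \<omega>)\<bar> \<ge> (\<epsilon> / 2) * N} \<union>
          {\<omega> \<in> space M. \<bar>\<Sum>i\<in>A. Im (X i \<omega>)\<bar> \<ge> (\<epsilon> / 2) * N}"
      by auto
  qed measurable
  also have "\<dots> \<le> prob {\<omega> \<in> space M. \<bar>\<Sum>i\<in>A. Re (X i \<omega>)\<bar> \<ge> (\<epsilon> / 2) * N} +
              prob {\<omega> \<in> space M. \<bar>\<Sum>i\<in>A. Im (X i \<omega>)\<bar> \<ge> (\<epsilon> / 2) * N}"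
    by (intro measure_Un_le) measurable
  also have "\<dots> \<le> 4 * exp (- ((\<epsilon> / 2)\<^sup>2 / (2 * K\<^sup>2)) * N)"
    using re im by linarith
  also have "(\<epsilon> / 2)\<^sup>2 / (2 * K\<^sup>2) = \<epsilon>\<^sup>2 / (8 * K\<^sup>2)"
    by (simp add: power2_eq_square)
  finally show ?thesis .
qed

text \<open>Different values of \<open>N\<close> may be arbitrarily dependent, so this is not an instance of a strong law
  of large numbers for one sequence. It holds because the tail bounds \<open>4 * q ^ N\<close> with \<open>q < 1\<close> are summable,
  which is all that the first Borel-Cantelli lemma asks for.\<close>

lemma AE_normalized_sum_tendsto_0:
  fixes X :: "nat \<Rightarrow> 'i \<Rightarrow> 'a \<Rightarrow> complex"
  assumes fin: "\<And>N. N \<in> I \<Longrightarrow> finite (A N)" and card: "\<And>N. N \<in> I \<Longrightarrow> card (A N) \<le> N"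
    and ind: "\<And>N. N \<in> I \<Longrightarrow> indep_vars (\<lambda>_. borel) (X N) (A N)"
    and bnd: "\<And>N i. N \<in> I \<Longrightarrow> i \<in> A N \<Longrightarrow> AE \<omega> in M. cmod (X N i \<omega>) \<le> K"
    and mean: "\<And>N i. N \<in> I \<Longrightarrow> i \<in> A N \<Longrightarrow> expectation (X N i) = 0"
    and K: "K > 0" and I: "0 \<notin> I"
  shows "AE \<omega> in M. ((\<lambda>N. (\<Sum>i\<in>A N. X N i \<omega>) / of_nat N) \<longlongrightarrow> 0) (along I)"
proof -
  \<comment> \<open>The thresholds \<open>1 / (k + 1)\<close> form a countable family that is cofinal among all \<open>\<epsilon> > 0\<close>.\<close>
  define B where "B k N = (if N \<in> I
      then {\<omega> \<in> space M. cmod (\<Sum>i\<in>A N. X N i \<omega>) \<ge> inverse (real (Suc k)) * N} else {})" for k N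
  have "AE \<omega> in M. \<forall>\<^sub>F N in sequentially. \<omega> \<in> space M - B k N" for k
  proof (rule borel_cantelli_AE1)
    show "B k N \<in> sets M" for N
    proof (cases "N \<in> I")
      case True
      then have [measurable]: "X N i \<in> borel_measurable M" if "i \<in> A N" for i
        using ind[OF True] that by (simp add: indep_vars_def)
      have "{\<omega> \<in> space M. cmod (\<Sum>i\<in>A N. X N i \<omega>) \<ge> inverse (real (Suc k)) * N} \<in> sets M"
        by measurable
      with True show ?thesis
        by (simp add: B_def del: of_nat_Suc)
    qed (simp add: B_def)
    show "emeasure M (B k N) < \<infinity>" for N
      by (simp add: less_top[symmetric])
    define q where "q = exp (- ((inverse (real (Suc k)))\<^sup>2 / (8 * K\<^sup>2)))"
    have q: "0 < q" "q < 1"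
      using K by (auto simp: q_def intro!: divide_pos_pos)
    show "summable (\<lambda>N. prob (B k N))"
    proof (rule summable_comparison_test')
      show "summable (\<lambda>N. 4 * q ^ N)"
        using q by (intro summable_mult summable_geometric) auto
      show "norm (prob (B k N)) \<le> 4 * q ^ N" if "N \<ge> 0" for N
      proof (cases "N \<in> I")
        case True
        with I have "N > 0" by (cases N) auto
        with True show ?thesis
          using prob_cmod_sum_centred_ge[OF fin[OF True] ind[OF True] bnd[OF True] mean[OF True]
              card[OF True] K, of "inverse (real (Suc k))"]
          by (simp add: B_def q_def mult.commute flip: exp_of_nat_mult)
      qed (use q in \<open>simp add: B_def\<close>)
    qed
  qed
  then have "AE \<omega> in M. \<forall>k. \<forall>\<^sub>F N in sequentially. \<omega> \<in> space M - B k N"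
    by (simp add: AE_all_countable)
  then show ?thesis
  proof eventually_elim
    case (elim \<omega>)
    show ?case
    proof (rule tendstoI)
      fix e :: real assume "e > 0"
      then obtain k where k: "inverse (real (Suc k)) < e"
        using reals_Archimedean by blast
      from elim have "\<forall>\<^sub>F N in sequentially. \<omega> \<in> space M - B k N" ..
      then show "\<forall>\<^sub>F N in along I. dist ((\<Sum>i\<in>A N. X N i \<omega>) / of_nat N) 0 < e"
        unfolding eventually_along
      proof (eventually_elim, safe)
        fix N assume *: "\<omega> \<in> space M" "\<omega> \<notin> B k N" "N \<in> I"
        with I have "N > 0" by (cases N) auto
        have "cmod (\<Sum>i\<in>A N. X N i \<omega>) < inverse (real (Suc k)) * N"
          using * by (simp add: B_def not_le)
        with \<open>N > 0\<close> have "cmod (\<Sum>i\<in>A N. X N i \<omega>) / N < inverse (real (Suc k))"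
          by (simp add: pos_divide_less_eq del: of_nat_Suc)
        with k show "dist ((\<Sum>i\<in>A N. X N i \<omega>) / of_nat N) 0 < e"
          by (simp add: norm_divide del: of_nat_Suc)
      qed
    qed
  qed
qed

end

section \<open>Decoupling the products along a permutation\<close>

lemma borel_measurable_cnj:
  assumes "f \<in> borel_measurable M"
  shows "(\<lambda>x. cnj (f x)) \<in> borel_measurable M"
  using assms by (rule borel_measurable_continuous_on[OF continuous_on_cnj[OF continuous_on_id]])

text \<open>A greedy colouring works: a new point \<open>z\<close> has at most two neighbours, its image and its
  preimage, so one of the three colours is free for it.\<close>

lemma ex_permutation_3_colouring:
  fixes p :: "'b \<Rightarrow> 'b"
  assumes p: "inj p" and F: "finite F"
  shows "\<exists>c. (\<forall>x. c x < (3::nat)) \<and> (\<forall>x\<in>F. p x \<in> F \<longrightarrow> p x \<noteq> x \<longrightarrow> c (p x) \<noteq> c x)"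
  using F
proof induction
  case empty
  show ?case by (rule exI[of _ "\<lambda>_. 0"]) simp
next
  case (insert z F)
  then obtain c :: "'b \<Rightarrow> nat" where c: "\<And>x. c x < 3"
    "\<And>x. x \<in> F \<Longrightarrow> p x \<in> F \<Longrightarrow> p x \<noteq> x \<Longrightarrow> c (p x) \<noteq> c x"
    by blast
  have "card {c (p z), c (inv_into UNIV p z)} < card {0, 1, 2::nat}"
    by (simp add: card_insert_if)
  then have "\<not> {0, 1, 2} \<subseteq> {c (p z), c (inv_into UNIV p z)}"
    by (metis card_mono finite.emptyI finite.insertI not_less)
  then obtain k where "k \<in> {0, 1, 2}" "k \<notin> {c (p z), c (inv_into UNIV p z)}"
    by blast
  then have k: "k < 3" "k \<noteq> c (p z)" "k \<noteq> c (inv_into UNIV p z)"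
    by auto
  have "(c(z := k)) (p x) \<noteq> (c(z := k)) x"
    if x: "x \<in> insert z F" "p x \<in> insert z F" "p x \<noteq> x" for x
  proof -
    consider "x = z" | "p x = z" | "x \<noteq> z" "p x \<noteq> z" by blast
    then show ?thesis
    proof cases
      case 1
      with x k show ?thesis by simp
    next
      case 2
      then have "inv_into UNIV p z = x"
        using inv_f_f[OF p] by blast
      with 2 x k show ?thesis by simp
    next
      case 3
      with x c(2) show ?thesis by simp
    qed
  qed
  moreover have "\<forall>x. (c(z := k)) x < 3"
    using c(1) k(1) by simp
  ultimately show ?case by blast
qed

context prob_space
begin

text \<open>The condition \<open>L \<inter> p ` L = {}\<close>, together with injectivity, makes the blocks \<open>{x, p x}\<close> for \<open>x \<in> L\<close>
  pairwise disjoint, and functions of disjoint blocks of independent variables are independent.\<close>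

lemma indep_vars_cnj_mult_shift:
  fixes X :: "'i \<Rightarrow> 'a \<Rightarrow> complex"
  assumes ind: "indep_vars (\<lambda>_. borel) X A" and L: "L \<subseteq> A" "p ` L \<subseteq> A"
    and inj: "inj_on p L" and disj: "L \<inter> p ` L = {}"
  shows "indep_vars (\<lambda>_. borel) (\<lambda>x \<omega>. cnj (X x \<omega>) * X (p x) \<omega>) L"
proof -
  have "indep_vars (\<lambda>x. PiM {x, p x} (\<lambda>_. borel)) (\<lambda>x \<omega>. restrict (\<lambda>y. X y \<omega>) {x, p x}) L"
    by (rule indep_vars_restrict[OF ind])
       (use L inj disj in \<open>auto simp: disjoint_family_on_def inj_on_def\<close>)
  then have "indep_vars (\<lambda>_. borel) 
     (\<lambda>x \<omega>. (\<lambda>f. cnj (f x) * f (p x)) (restrict (\<lambda>y. X y \<omega>) {x, p x})) L"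
    by (rule indep_vars_compose2[where Y = "\<lambda>x f. cnj (f x) * f (p x)"])
       (intro borel_measurable_times borel_measurable_cnj measurable_component_singleton; simp)
  then show ?thesis by simp
qed

lemma expectation_cnj_mult_indep:
  fixes X :: "'i \<Rightarrow> 'a \<Rightarrow> complex"
  assumes ind: "indep_vars (\<lambda>_. borel) X A" and xy: "x \<in> A" "y \<in> A" "x \<noteq> y"
    and int: "integrable M (X x)" "integrable M (X y)"
  shows "expectation (\<lambda>\<omega>. cnj (X x \<omega>) * X y \<omega>) = cnj (expectation (X x)) * expectation (X y)"
proof -
  have "indep_var (PiM {x} (\<lambda>_. borel)) (\<lambda>\<omega>. restrict (\<lambda>i. X i \<omega>) {x})
                  (PiM {y} (\<lambda>_. borel)) (\<lambda>\<omega>. restrict (\<lambda>i. X i \<omega>) {y})"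
    by (rule indep_var_restrict[OF ind]) (use xy in auto)
  then have "indep_var borel ((\<lambda>f. cnj (f x)) \<circ> (\<lambda>\<omega>. restrict (\<lambda>i. X i \<omega>) {x}))
                  borel ((\<lambda>f. f y) \<circ> (\<lambda>\<omega>. restrict (\<lambda>i. X i \<omega>) {y}))"
    by (rule indep_var_compose)
       (intro borel_measurable_cnj measurable_component_singleton; simp)+
  then have "indep_var borel (\<lambda>\<omega>. cnj (X x \<omega>)) borel (X y)"
    by (simp add: comp_def)
  from indep_var_lebesgue_integral[OF this] int show ?thesis by simp
qed

end

section \<open>Almost sure decay of the autocorrelation\<close>

text \<open>The empirical mean is an inconvenient centring because it depends on all the variables at once. Both
  \<open>x \<mapsto> a x\<close> and \<open>x \<mapsto> a (p x)\<close> have the same average, so replacing the empirical mean by a constant \<open>\<mu>\<close> costs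
  only the square of the average of \<open>a - \<mu>\<close>.\<close>

lemma autocorrelation_centred:
  assumes p: "p permutes {1..N}" and N: "N > 0"
  shows "autocorrelation N a p =
    (\<Sum>x\<in>{1..N}. cnj (a x - \<mu>) * (a (p x) - \<mu>)) / of_nat N
      - cnj (avg N (\<lambda>x. a x - \<mu>)) * avg N (\<lambda>x. a x - \<mu>)"
proof -
  define b where "b x = a x - \<mu>" for x
  define m where "m = avg N b"
  have m: "avg N a = m + \<mu>"
    using N by (simp add: m_def b_def avg_def sum_subtractf field_simps)
  have s: "(\<Sum>x\<in>{1..N}. b x) = of_nat N * m"
    using N by (simp add: m_def avg_def)
  have sp: "(\<Sum>x\<in>{1..N}. b (p x)) = of_nat N * m"
    using s sum.permute[OF p, of b] by (simp add: comp_def)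
  have "(\<Sum>x\<in>{1..N}. cnj (a x - avg N a) * (a (p x) - avg N a))
      = (\<Sum>x\<in>{1..N}. cnj (b x - m) * (b (p x) - m))"
    by (simp add: m b_def algebra_simps)
  also have "\<dots> = (\<Sum>x\<in>{1..N}. cnj (b x) * b (p x) - cnj m * b (p x) - cnj (b x) * m + cnj m * m)"
    by (simp add: algebra_simps)
  also have "\<dots> = (\<Sum>x\<in>{1..N}. cnj (b x) * b (p x)) - cnj m * (\<Sum>x\<in>{1..N}. b (p x))
      - cnj (\<Sum>x\<in>{1..N}. b x) * m + of_nat N * (cnj m * m)"
    by (simp add: sum.distrib sum_subtractf sum_distrib_left sum_distrib_right)
  also have "\<dots> = (\<Sum>x\<in>{1..N}. cnj (b x) * b (p x)) - of_nat N * (cnj m * m)"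
    unfolding s sp by (simp add: algebra_simps)
  finally show ?thesis
    using N by (simp add: autocorrelation_def b_def[symmetric] m_def[symmetric] diff_divide_distrib)
qed

text \<open>Splits the centred sum into the fixed points of \<open>p\<close>, which are bounded trivially, and the colour
  classes of the other points, to be handled by concentration.\<close>

lemma cmod_autocorrelation_le:
  assumes p: "p permutes {1..N}" and N: "N > 0"
    and bnd: "\<And>x. x \<in> {1..N} \<Longrightarrow> cmod (a x - \<mu>) \<le> K"
    and c: "\<And>x. c x < (k::nat)"
  shows "cmod (autocorrelation N a p) \<le>
    (cmod (avg N (\<lambda>x. a x - \<mu>)))\<^sup>2 + K\<^sup>2 * (real (card {x \<in> {1..N}. p x = x}) / real N)
    + (\<Sum>j<k. cmod ((\<Sum>x\<in>{x \<in> {1..N}. p x \<noteq> x \<and> c x = j}. cnj (a x - \<mu>) * (a (p x) - \<mu>)) / of_nat N))"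
proof -
  define Y where "Y x = cnj (a x - \<mu>) * (a (p x) - \<mu>)" for x
  define m where "m = avg N (\<lambda>x. a x - \<mu>)"
  define F where "F = {x \<in> {1..N}. p x = x}"
  define L where "L j = {x \<in> {1..N}. p x \<noteq> x \<and> c x = j}" for j
  have Y: "cmod (Y x) \<le> K\<^sup>2" if "x \<in> {1..N}" for x
  proof -
    have "p x \<in> {1..N}" using that p by (simp only: permutes_in_image)
    then show ?thesis
      unfolding Y_def norm_mult complex_mod_cnj power2_eq_square
      using that bnd[OF that] order_trans[OF norm_ge_zero bnd[OF that]] by (intro mult_mono bnd) auto
  qed
  have split: "{1..N} = F \<union> (\<Union>j<k. L j)"
    using c by (auto simp: F_def L_def)
  have "(\<Sum>x\<in>{1..N}. Y x) = (\<Sum>x\<in>F. Y x) + (\<Sum>x\<in>(\<Union>j<k. L j). Y x)"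
    unfolding split by (rule sum.union_disjoint) (auto simp: F_def L_def)
  also have "(\<Sum>x\<in>(\<Union>j<k. L j). Y x) = (\<Sum>j<k. \<Sum>x\<in>L j. Y x)"
    by (rule sum.UNION_disjoint) (auto simp: L_def)
  finally have sum_eq: "(\<Sum>x\<in>{1..N}. Y x) = (\<Sum>x\<in>F. Y x) + (\<Sum>j<k. \<Sum>x\<in>L j. Y x)" .
  have "autocorrelation N a p = (\<Sum>x\<in>{1..N}. Y x) / of_nat N - cnj m * m"
    unfolding Y_def m_def by (rule autocorrelation_centred[OF p N])
  also have "\<dots> = (\<Sum>x\<in>F. Y x) / of_nat N + (\<Sum>j<k. \<Sum>x\<in>L j. Y x) / of_nat N - cnj m * m"
    by (simp only: sum_eq add_divide_distrib)
  also have "(\<Sum>j<k. \<Sum>x\<in>L j. Y x) / of_nat N = (\<Sum>j<k. (\<Sum>x\<in>L j. Y x) / of_nat N)"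
    by (rule sum_divide_distrib)
  finally have eq: "autocorrelation N a p = (\<Sum>x\<in>F. Y x) / of_nat N
      + (\<Sum>j<k. (\<Sum>x\<in>L j. Y x) / of_nat N) - cnj m * m" .
  have "cmod (autocorrelation N a p) \<le> cmod ((\<Sum>x\<in>F. Y x) / of_nat N)
      + cmod (\<Sum>j<k. (\<Sum>x\<in>L j. Y x) / of_nat N) + cmod (cnj m * m)"
    unfolding eq by (rule order_trans[OF norm_triangle_ineq4 add_right_mono[OF norm_triangle_ineq]])
  moreover have "cmod (\<Sum>x\<in>F. Y x) \<le> of_nat (card F) * K\<^sup>2"
    by (rule sum_norm_bound) (use Y in \<open>auto simp: F_def\<close>)
  then have "cmod ((\<Sum>x\<in>F. Y x) / of_nat N) \<le> K\<^sup>2 * (real (card F) / real N)"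
    using N by (simp add: norm_divide divide_right_mono mult.commute)
  moreover have "cmod (\<Sum>j<k. (\<Sum>x\<in>L j. Y x) / of_nat N) \<le> (\<Sum>j<k. cmod ((\<Sum>x\<in>L j. Y x) / of_nat N))"
    by (rule norm_sum)
  moreover have "cmod (cnj m * m) = (cmod m)\<^sup>2"
    by (simp add: norm_mult power2_eq_square)
  ultimately have "cmod (autocorrelation N a p) \<le> (cmod m)\<^sup>2 + K\<^sup>2 * (real (card F) / real N)
      + (\<Sum>j<k. cmod ((\<Sum>x\<in>L j. Y x) / of_nat N))"
    by linarith
  then show ?thesis
    by (simp only: Y_def m_def F_def L_def)
qed

lemma (in prob_space) AE_autocorrelation_tendsto_0:
  fixes a :: "nat \<Rightarrow> nat \<Rightarrow> 'a \<Rightarrow> complex"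
  assumes I: "0 \<notin> I" and p: "\<And>N. N \<in> I \<Longrightarrow> p N permutes {1..N}"
    and fixpts: "((\<lambda>N. real (card {x \<in> {1..N}. p N x = x}) / real N) \<longlongrightarrow> 0) (along I)"
    and ind: "\<And>N. N \<in> I \<Longrightarrow> indep_vars (\<lambda>_. borel) (a N) {1..N}"
    and bnd: "\<And>N x. N \<in> I \<Longrightarrow> x \<in> {1..N} \<Longrightarrow> AE \<omega> in M. cmod (a N x \<omega>) \<le> 1"
    and mean: "\<And>N x. N \<in> I \<Longrightarrow> x \<in> {1..N} \<Longrightarrow> expectation (a N x) = \<mu> N"
  shows "AE \<omega> in M. ((\<lambda>N. autocorrelation N (\<lambda>x. a N x \<omega>) (p N)) \<longlongrightarrow> 0) (along I)"
proof -
  define X where "X N x \<omega> = a N x \<omega> - \<mu> N" for N x \<omega>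
  have meas: "a N x \<in> borel_measurable M" if "N \<in> I" "x \<in> {1..N}" for N x
    using ind[OF that(1)] that(2) by (simp add: indep_vars_def)
  have int: "integrable M (a N x)" if "N \<in> I" "x \<in> {1..N}" for N x
    using bnd[OF that] meas[OF that] by (rule integrable_const_bound)
  have \<mu>: "cmod (\<mu> N) \<le> 1" if "N \<in> I" for N
  proof -
    from that I have 1: "1 \<in> {1..N}" by (cases N) auto
    have "cmod (\<mu> N) \<le> expectation (\<lambda>\<omega>. cmod (a N 1 \<omega>))"
      unfolding mean[OF that 1, symmetric] by (rule integral_norm_bound)
    also have "\<dots> \<le> expectation (\<lambda>_. 1)"
      by (rule integral_mono_AE) (use int[OF that 1] bnd[OF that 1] in auto)
    finally show ?thesis by (simp add: prob_space)
  qed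
  have X_ind: "indep_vars (\<lambda>_. borel) (X N) {1..N}" if "N \<in> I" for N
    unfolding X_def by (rule indep_vars_compose2[OF ind[OF that]]) simp
  have X_int: "integrable M (X N x)" if "N \<in> I" "x \<in> {1..N}" for N x
    unfolding X_def using int[OF that] by simp
  have X_bnd: "AE \<omega> in M. cmod (X N x \<omega>) \<le> 2" if "N \<in> I" "x \<in> {1..N}" for N x
    using bnd[OF that]
  proof eventually_elim
    case (elim \<omega>)
    then show ?case
      using \<mu>[OF that(1)] norm_triangle_ineq4[of "a N x \<omega>" "\<mu> N"] by (simp add: X_def)
  qed
  have X_mean: "expectation (X N x) = 0" if "N \<in> I" "x \<in> {1..N}" for N x
    unfolding X_def using int[OF that] mean[OF that] by (simp add: prob_space)

  \<comment> \<open>The colouring depends on \<open>N\<close> but is deterministic, so independence within a class is preserved.\<close>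
  have "\<exists>c. (\<forall>x. c x < (3::nat)) \<and>
      (\<forall>x\<in>{1..N}. p N x \<in> {1..N} \<longrightarrow> p N x \<noteq> x \<longrightarrow> c (p N x) \<noteq> c x)" if "N \<in> I" for N
    by (rule ex_permutation_3_colouring[OF permutes_inj[OF p[OF that]] finite_atLeastAtMost])
  then have "\<forall>N\<in>I. \<exists>c. (\<forall>x. c x < (3::nat)) \<and>
      (\<forall>x\<in>{1..N}. p N x \<in> {1..N} \<longrightarrow> p N x \<noteq> x \<longrightarrow> c (p N x) \<noteq> c x)" ..
  from bchoice[OF this] obtain c where c: "\<And>N x. N \<in> I \<Longrightarrow> c N x < (3::nat)"
    and proper: "\<And>N x. N \<in> I \<Longrightarrow> x \<in> {1..N} \<Longrightarrow> p N x \<in> {1..N} \<Longrightarrow> p N x \<noteq> x \<Longrightarrow>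
      c N (p N x) \<noteq> c N x"
    by blast
  define L where "L j N = {x \<in> {1..N}. p N x \<noteq> x \<and> c N x = j}" for j N
  define Y where "Y N x \<omega> = cnj (X N x \<omega>) * X N (p N x) \<omega>" for N x \<omega>

  have pN: "p N x \<in> {1..N}" if "N \<in> I" "x \<in> {1..N}" for N x
    using p[OF that(1)] that(2) by (simp only: permutes_in_image)
  have class_lim: "AE \<omega> in M. ((\<lambda>N. (\<Sum>x\<in>L j N. Y N x \<omega>) / of_nat N) \<longlongrightarrow> 0) (along I)" for j
  proof (rule AE_normalized_sum_tendsto_0[where K = 4])
    fix N assume N: "N \<in> I"
    show "finite (L j N)" by (simp add: L_def)
    show "card (L j N) \<le> N"
    proof -
      have "card (L j N) \<le> card {1..N}"
        by (rule card_mono) (auto simp: L_def)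
      then show ?thesis by simp
    qed
    show "indep_vars (\<lambda>_. borel) (Y N) (L j N)"
      unfolding Y_def
    proof (rule indep_vars_cnj_mult_shift[OF X_ind[OF N]])
      show "p N ` L j N \<subseteq> {1..N}"
        unfolding L_def using pN[OF N] by blast
      show "inj_on (p N) (L j N)"
        using permutes_inj[OF p[OF N]] by (rule inj_on_subset) simp
      show "L j N \<inter> p N ` L j N = {}"
      proof -
        have False if "x \<in> L j N" "p N x \<in> L j N" for x
          using proper[OF N, of x] pN[OF N, of x] that by (simp add: L_def)
        then show ?thesis by blast
      qed
    qed (auto simp: L_def)
    fix x assume "x \<in> L j N"
    then have x: "x \<in> {1..N}" "x \<noteq> p N x" by (auto simp: L_def)
    show "AE \<omega> in M. cmod (Y N x \<omega>) \<le> 4"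
      using X_bnd[OF N x(1)] X_bnd[OF N pN[OF N x(1)]]
    proof eventually_elim
      case (elim \<omega>)
      then show ?case
        using mult_mono[OF elim] by (simp add: Y_def norm_mult)
    qed
    show "expectation (Y N x) = 0"
      unfolding Y_def
      using expectation_cnj_mult_indep[OF X_ind[OF N] x(1) pN[OF N x(1)] x(2)]
        X_int[OF N x(1)] X_int[OF N pN[OF N x(1)]] X_mean[OF N x(1)] by simp
  qed (use I in auto)
  have "AE \<omega> in M. \<forall>j. ((\<lambda>N. (\<Sum>x\<in>L j N. Y N x \<omega>) / of_nat N) \<longlongrightarrow> 0) (along I)"
    unfolding AE_all_countable using class_lim by blast
  moreover have "AE \<omega> in M. ((\<lambda>N. (\<Sum>x\<in>{1..N}. X N x \<omega>) / of_nat N) \<longlongrightarrow> 0) (along I)"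
    by (rule AE_normalized_sum_tendsto_0[where K = 2]) (use X_ind X_bnd X_mean I in auto)
  moreover have "AE \<omega> in M. \<forall>N\<in>I. \<forall>x\<in>{1..N}. cmod (X N x \<omega>) \<le> 2"
    using X_bnd by (simp add: AE_ball_countable)
  ultimately show ?thesis
  proof eventually_elim
    case (elim \<omega>)
    let ?bound = "\<lambda>N. (cmod ((\<Sum>x\<in>{1..N}. X N x \<omega>) / of_nat N))\<^sup>2
      + 2\<^sup>2 * (real (card {x \<in> {1..N}. p N x = x}) / real N)
      + (\<Sum>j<3. cmod ((\<Sum>x\<in>L j N. Y N x \<omega>) / of_nat N))"
    have "(?bound \<longlongrightarrow> 0\<^sup>2 + 2\<^sup>2 * 0 + (\<Sum>j<(3::nat). 0)) (along I)"
      using elim(1)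
      by (intro tendsto_add tendsto_sum tendsto_power tendsto_mult tendsto_const fixpts
          tendsto_norm_zero[OF elim(2)] tendsto_norm_zero) blast
    then have "(?bound \<longlongrightarrow> 0) (along I)" by simp
    moreover have "\<forall>\<^sub>F N in along I. cmod (autocorrelation N (\<lambda>x. a N x \<omega>) (p N)) \<le> ?bound N"
      unfolding eventually_along
    proof (intro always_eventually allI impI)
      fix N assume N: "N \<in> I"
      with I have "N > 0" by (cases N) auto
      have "cmod (a N x \<omega> - \<mu> N) \<le> 2" if "x \<in> {1..N}" for x
        using elim(3) N that unfolding X_def by blast
      from cmod_autocorrelation_le[OF p[OF N] \<open>N > 0\<close>, where a = "\<lambda>x. a N x \<omega>" and \<mu> = "\<mu> N",
          OF this c[OF N]]
      show "cmod (autocorrelation N (\<lambda>x. a N x \<omega>) (p N)) \<le> ?bound N"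
        unfolding X_def Y_def L_def avg_def .
    qed
    ultimately show ?case
      by (rule Lim_null_comparison[rotated])
  qed
qed

section \<open>From single group elements to the whole group\<close>

text \<open>Every element of the generated subgroup is the value of a finite word in the generators and
  their inverses, and there are only countably many such words.\<close>

lemma (in group) countable_generate:
  assumes S: "S \<subseteq> carrier G" "countable S"
  shows "countable (generate G S)"
proof -
  define T where "T = S \<union> (\<lambda>s. inv s) ` S"
  define w where "w = (\<lambda>ws. foldr (\<otimes>) ws \<one>)"
  have T: "T \<subseteq> carrier G" using S by (auto simp: T_def)
  have w: "w us \<in> carrier G" if "us \<in> lists T" for us
    using that T by (induction us) (auto simp: w_def)
  have app: "w (us @ vs) = w us \<otimes> w vs" if "us \<in> lists T" "vs \<in> lists T" for us vs
    using that(1)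
  proof induction
    case Nil
    show ?case using w[OF that(2)] by (simp add: w_def)
  next
    case (Cons u us)
    then show ?case
      using w[OF that(2)] w[of us] T by (auto simp: w_def m_assoc)
  qed
  have "h \<in> w ` lists T" if "h \<in> generate G S" for h
    using that
  proof induction
    case one
    show ?case by (rule image_eqI[of _ _ "[]"]) (auto simp: w_def)
  next
    case (incl h)
    then show ?case by (intro image_eqI[of _ _ "[h]"]) (use S in \<open>auto simp: w_def T_def\<close>)
  next
    case (inv h)
    then show ?case by (intro image_eqI[of _ _ "[inv h]"]) (use S in \<open>auto simp: w_def T_def\<close>)
  next
    case (eng h1 h2)
    then obtain us vs where "us \<in> lists T" "vs \<in> lists T" "h1 = w us" "h2 = w vs" by auto
    then show ?case by (intro image_eqI[of _ _ "us @ vs"]) (auto simp: app)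
  qed
  then have "generate G S \<subseteq> w ` lists T" by blast
  moreover have "countable (w ` lists T)"
    using S by (intro countable_image countable_lists) (simp add: T_def)
  ultimately show ?thesis by (rule countable_subset)
qed

lemma matrix_trace_perm_matrix:
  "matrix_trace N (perm_matrix p) = of_nat (card {x \<in> {1..N}. p x = x})"
proof -
  have "matrix_trace N (perm_matrix p) = (\<Sum>x\<in>{1..N}. if p x = x then 1 else 0)"
    unfolding matrix_trace_def perm_matrix_def by (rule sum.cong) auto
  also have "\<dots> = of_nat (card {x \<in> {1..N}. p x = x})"
    by (simp add: sum.If_cases Int_def)
  finally show ?thesis .
qed

text \<open>The identity has a fixed word length, so elements of larger word length differ from it and
  the correlation is eventually zero, not merely convergent to zero.\<close>

lemma asymp_uncorrelatedI:
  assumes "\<And>g. g \<in> carrier G - {\<one>\<^bsub>G\<^esub>} \<Longrightarrow> asymp_correlation I \<rho> a g = 0"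
  shows "asymp_uncorrelated G S I \<rho> a"
  unfolding asymp_uncorrelated_def
proof (rule tendsto_eventually)
  let ?n = "word_length G S \<one>\<^bsub>G\<^esub>"
  have "\<forall>\<^sub>F g in filtercomap (word_length G S) at_top. ?n < word_length G S g"
    by (rule eventually_filtercomapI[OF eventually_gt_at_top])
  then show "\<forall>\<^sub>F g in inf (filtercomap (word_length G S) at_top) (principal (carrier G)).
      asymp_correlation I \<rho> a g = 0"
    unfolding eventually_inf_principal
  proof eventually_elim
    case (elim g)
    then have "g \<noteq> \<one>\<^bsub>G\<^esub>" by auto
    with assms show ?case by blast
  qed
qed

text \<open>Infinitude of \<open>I\<close> makes the filter proper; for the trivial filter the limit superior would be
  \<open>-\<infinity>\<close>.\<close>

lemma asymp_correlation_eq_0: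
  assumes "infinite I"
    and lim: "((\<lambda>N. autocorrelation N (a N) (\<rho> N g)) \<longlongrightarrow> 0) (along I)"
  shows "asymp_correlation I \<rho> a g = 0"
  unfolding asymp_correlation_def
proof (rule lim_imp_Limsup)
  show "\<not> trivial_limit (along I)"
  proof
    assume "trivial_limit (along I)"
    then have "\<forall>\<^sub>F N in along I. False"
      by (simp add: trivial_limit_def)
    then have "\<forall>\<^sub>F N in sequentially. N \<notin> I"
      by (simp add: eventually_along)
    with \<open>infinite I\<close> show False
      by (simp add: infinite_nat_iff_unbounded_le eventually_sequentially) blast
  qed
  show "((\<lambda>N. ereal (cmod (autocorrelation N (a N) (\<rho> N g)))) \<longlongrightarrow> 0) (along I)"
    using tendsto_norm_zero[OF lim] by (simp add: zero_ereal_def)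
qed

theorem lemma1p2:
  fixes G :: "('g, 'm) monoid_scheme" and S :: "'g set"
    and I :: "nat set" and \<rho> :: "nat \<Rightarrow> 'g \<Rightarrow> nat \<Rightarrow> nat"
    and M :: "'w measure" and a :: "nat \<Rightarrow> nat \<Rightarrow> 'w \<Rightarrow> complex"
  assumes "group G"
    and "finite S" and "S \<subseteq> carrier G" and "generate G S = carrier G"
    and "infinite I" and "0 \<notin> I"
    and "\<And>N. N \<in> I \<Longrightarrow> \<rho> N \<in> hom G (sym_group N)"
    and "converges_to_regular G I \<rho>"
    and "prob_space M"
    and "\<And>N. N \<in> I \<Longrightarrow> prob_space.indep_vars M (\<lambda>_. borel) (a N) {1..N}"
    and "\<And>N. N \<in> I \<Longrightarrow> AE \<omega> in M. (MAX x\<in>{1..N}. cmod (a N x \<omega>)) \<le> 1"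
    and "\<And>N x y. N \<in> I \<Longrightarrow> x \<in> {1..N} \<Longrightarrow> y \<in> {1..N} \<Longrightarrow>
           prob_space.expectation M (a N x) = prob_space.expectation M (a N y)"
  shows "(AE \<omega> in M. \<forall>g\<in>carrier G - {\<one>\<^bsub>G\<^esub>}.
            asymp_correlation I \<rho> (\<lambda>N x. a N x \<omega>) g = 0) \<and>
         (AE \<omega> in M. asymp_uncorrelated G S I \<rho> (\<lambda>N x. a N x \<omega>))"
proof -
  interpret group G by fact
  interpret prob_space M by fact
  have "countable (carrier G)"
    using countable_generate[of S] assms by (simp add: countable_finite)
  then have cnt: "countable (carrier G - {\<one>\<^bsub>G\<^esub>})" by simp
  have "AE \<omega> in M. asymp_correlation I \<rho> (\<lambda>N x. a N x \<omega>) g = 0"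
    if g: "g \<in> carrier G - {\<one>\<^bsub>G\<^esub>}" for g
  proof -
    have "AE \<omega> in M. ((\<lambda>N. autocorrelation N (\<lambda>x. a N x \<omega>) (\<rho> N g)) \<longlongrightarrow> 0) (along I)"
    proof (rule AE_autocorrelation_tendsto_0[OF \<open>0 \<notin> I\<close>])
      have "((\<lambda>N. matrix_trace N (perm_matrix (\<rho> N g)) / of_nat N) \<longlongrightarrow> 0) (along I)"
        using assms(8) g by (simp add: converges_to_regular_def)
      from tendsto_norm_zero[OF this]
      show "((\<lambda>N. real (card {x \<in> {1..N}. \<rho> N g x = x}) / real N) \<longlongrightarrow> 0) (along I)"
        by (simp add: matrix_trace_perm_matrix norm_divide)
      fix N assume N: "N \<in> I"
      show "\<rho> N g permutes {1..N}"
        using hom_in_carrier[OF assms(7)[OF N]] g by (simp add: sym_group_carrier)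
      show "indep_vars (\<lambda>_. borel) (a N) {1..N}"
        by (rule assms(10)[OF N])
      fix x assume x: "x \<in> {1..N}"
      show "AE \<omega> in M. cmod (a N x \<omega>) \<le> 1"
        using assms(11)[OF N]
      proof eventually_elim
        case (elim \<omega>)
        have "cmod (a N x \<omega>) \<le> (MAX x\<in>{1..N}. cmod (a N x \<omega>))"
          by (rule Max_ge) (use x in auto)
        with elim show ?case by linarith
      qed
      show "expectation (a N x) = expectation (a N 1)"
        by (rule assms(12)[OF N x]) (use x in auto)
    qed
    then show ?thesis
      by eventually_elim (rule asymp_correlation_eq_0[OF \<open>infinite I\<close>])
  qed
  then have *: "AE \<omega> in M. \<forall>g\<in>carrier G - {\<one>\<^bsub>G\<^esub>}. asymp_correlation I \<rho> (\<lambda>N x. a N x \<omega>) g = 0"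
    by (simp add: AE_ball_countable[OF cnt])
  moreover from * have "AE \<omega> in M. asymp_uncorrelated G S I \<rho> (\<lambda>N x. a N x \<omega>)"
    by eventually_elim (rule asymp_uncorrelatedI, blast)
  ultimately show ?thesis ..
qed

end
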